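(* For all positive integers $n\ge 2$ and $1\le r\le n-1$, \[ M(n,0,r)=\binom{n-r+1}{2}. \]
   Context: All graphs are finite and simple. For a vertex $u$ of a graph $G$, $N[u]$ is its closed neighborhood (the set consisting of $u$ and all vertices adjacent to $u$). A set $S\subseteq V(G)$ is dominating if every vertex of $G$ lies in $N[s]$ for some $s\in S$. A vertex $u\in V(G)$ is overdominated by $S$ if $|N[u]\cap S|\ge 2$. The cardinality-redundance $CR(S)$ is the number of vertices of $G$ overdominated by $S$, and $CR(G)$ is the minimum of $CR(S)$ over all dominating sets $S$ of $G$. $\gamma_{CR}(G)$ is the minimum size of a dominating set $S$ with $CR(S)=CR(G)$. For integers $k\ge 0$ and $n,r\ge 1$ with $k\le n$, $r\le n$, $M(n,k,r)$ is the maximum of $|E(G)|$ over all graphs $G$ with $|V(G)|=n$, $CR(G)=k$ and $\gamma_{CR}(G)=r$; if no such graph exists, $M(n,k,r)=0$. *)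

theory Defs
  imports Main
begin

definition simple_graph :: "'a set \<Rightarrow> 'a set set \<Rightarrow> bool" where
  "simple_graph V E \<longleftrightarrow> finite V \<and> (\<forall>e\<in>E. e \<subseteq> V \<and> card e = 2)"

definition closed_nbhd :: "'a set \<Rightarrow> 'a set set \<Rightarrow> 'a \<Rightarrow> 'a set" where
  "closed_nbhd V E u = insert u {v \<in> V. {u, v} \<in> E}"

definition dominating :: "'a set \<Rightarrow> 'a set set \<Rightarrow> 'a set \<Rightarrow> bool" where
  "dominating V E S \<longleftrightarrow> S \<subseteq> V \<and> (\<forall>v\<in>V. \<exists>s\<in>S. v \<in> closed_nbhd V E s)"

definition overdominated :: "'a set \<Rightarrow> 'a set set \<Rightarrow> 'a set \<Rightarrow> 'a \<Rightarrow> bool" where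
  "overdominated V E S u \<longleftrightarrow> u \<in> V \<and> card (closed_nbhd V E u \<inter> S) \<ge> 2"

definition CR_set :: "'a set \<Rightarrow> 'a set set \<Rightarrow> 'a set \<Rightarrow> nat" where
  "CR_set V E S = card {u. overdominated V E S u}"

text \<open>For a simple graph, the two minima below range over finite nonempty sets: every
  dominating set is a subset of the finite set \<open>V\<close>, and \<open>V\<close> itself is dominating.\<close>

definition CR :: "'a set \<Rightarrow> 'a set set \<Rightarrow> nat" where
  "CR V E = Min {CR_set V E S | S. dominating V E S}"

definition gamma_CR :: "'a set \<Rightarrow> 'a set set \<Rightarrow> nat" where
  "gamma_CR V E = Min {card S | S. dominating V E S \<and> CR_set V E S = CR V E}"

text \<open>Every finite graph is isomorphic to one whose vertices are natural numbers, and all the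
  quantities involved are isomorphism invariants, so it suffices to let \<open>V\<close> range over finite
  sets of naturals. The set is finite, since a graph on \<open>n\<close> vertices has at most
  \<open>n choose 2\<close> edges.\<close>

definition edge_counts :: "nat \<Rightarrow> nat \<Rightarrow> nat \<Rightarrow> nat set" where
  "edge_counts n k r =
    {card E | (V :: nat set) E. simple_graph V E \<and> card V = n \<and> CR V E = k \<and> gamma_CR V E = r}"

definition M :: "nat \<Rightarrow> nat \<Rightarrow> nat \<Rightarrow> nat" where
  "M n k r = (if edge_counts n k r = {} then 0 else Max (edge_counts n k r))"

end

theory Submission
  imports Defs
begin

text \<open>A graph has cardinality-redundance zero iff some dominating set \<open>S\<close> overdominates no vertex,
  that is, iff the closed neighbourhoods of the members of \<open>S\<close> partition the vertex set.  Then no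
  edge lies inside \<open>S\<close>, and every vertex outside \<open>S\<close> has exactly one neighbour in \<open>S\<close>.  With
  \<open>r = |S|\<close> and \<open>n\<close> vertices there are thus at most \<open>n - r\<close> edges meeting \<open>S\<close> and at most
  \<open>(n - r) choose 2\<close> edges avoiding it, which adds up to \<open>(n - r + 1) choose 2\<close>
  (\<open>card_edges_le\<close>).  The bound is attained by the disjoint union of a complete graph on
  \<open>n - r + 1\<close> vertices and \<open>r - 1\<close> isolated vertices: a dominating set must contain every isolated
  vertex and meet the clique, and one with a single clique vertex overdominates nothing
  (\<open>extremal_graph\<close>).\<close>

lemma finite_edges: "simple_graph V E \<Longrightarrow> finite E"
  by (rule finite_subset[of _ "Pow V"]) (auto simp: simple_graph_def)

lemma finite_dominating_image:
  assumes "simple_graph V E"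
  shows "finite {f S | S. dominating V E S \<and> P S}"
proof -
  have "{f S | S. dominating V E S \<and> P S} \<subseteq> f ` Pow V"
    by (auto simp: dominating_def)
  moreover have "finite (f ` Pow V)"
    using assms by (simp add: simple_graph_def)
  ultimately show ?thesis by (rule finite_subset)
qed

lemma dominating_vertices: "dominating V E V"
  by (auto simp: dominating_def closed_nbhd_def)

lemma CR_attained:
  assumes "simple_graph V E"
  obtains S where "dominating V E S" "CR_set V E S = CR V E"
proof -
  have "CR V E \<in> {CR_set V E S | S. dominating V E S}"
    unfolding CR_def
    using finite_dominating_image[OF assms, of "CR_set V E" "\<lambda>_. True"] dominating_vertices
    by (intro Min_in) auto
  then show ?thesis using that by auto
qed

lemma gamma_CR_attained:
  assumes "simple_graph V E"
  obtains S where "dominating V E S" "CR_set V E S = CR V E" "card S = gamma_CR V E"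
proof -
  have "gamma_CR V E \<in> {card S | S. dominating V E S \<and> CR_set V E S = CR V E}"
    unfolding gamma_CR_def
  proof (rule Min_in)
    show "finite {card S | S. dominating V E S \<and> CR_set V E S = CR V E}"
      by (rule finite_dominating_image[OF assms])
    obtain S where "dominating V E S" "CR_set V E S = CR V E"
      using CR_attained[OF assms] .
    then show "{card S | S. dominating V E S \<and> CR_set V E S = CR V E} \<noteq> {}"
      by auto
  qed
  then show ?thesis using that by auto
qed

lemma CR_set_eq_0_iff:
  assumes "simple_graph V E"
  shows "CR_set V E S = 0 \<longleftrightarrow> (\<forall>u\<in>V. card (closed_nbhd V E u \<inter> S) \<le> 1)"
proof -
  have "finite {u. overdominated V E S u}"
    by (rule finite_subset[of _ V]) (use assms in \<open>auto simp: overdominated_def simple_graph_def\<close>)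
  then show ?thesis
    by (fastforce simp: CR_set_def overdominated_def)
qed

lemma unique_dominator:
  assumes G: "simple_graph V E" and zero: "CR_set V E S = 0"
    and u: "u \<in> V" and "a \<in> closed_nbhd V E u \<inter> S" "b \<in> closed_nbhd V E u \<inter> S"
  shows "a = b"
proof -
  have "closed_nbhd V E u \<subseteq> V" using u by (auto simp: closed_nbhd_def)
  then have "finite (closed_nbhd V E u \<inter> S)"
    using G by (auto simp: simple_graph_def intro: finite_subset)
  moreover have "card (closed_nbhd V E u \<inter> S) \<le> 1"
    using CR_set_eq_0_iff[OF G] zero u by blast
  ultimately show ?thesis
    using assms(4,5) by (metis One_nat_def card_le_Suc0_iff_eq)
qed

lemma Suc_choose_two: "Suc m choose 2 = (m choose 2) + m"
  by (simp add: numeral_2_eq_2)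

lemma card_edges_le:
  assumes G: "simple_graph V E" and D: "dominating V E S" and zero: "CR_set V E S = 0"
  shows "card E \<le> (card V - card S + 1) choose 2"
proof -
  define T where "T = V - S"
  define f where "f t = (SOME s. s \<in> S \<and> {t, s} \<in> E)" for t
  have V: "finite V" and SV: "S \<subseteq> V"
    and edge: "\<And>e. e \<in> E \<Longrightarrow> e \<subseteq> V \<and> card e = 2"
    using G D by (auto simp: simple_graph_def dominating_def)
  have T: "finite T" "card T = card V - card S"
    using V SV by (auto simp: T_def card_Diff_subset finite_subset)
  \<comment> \<open>Edges meeting \<open>S\<close> are determined by their end outside \<open>S\<close>.\<close>
  have cross: "e \<in> (\<lambda>t. {t, f t}) ` T" if e: "e \<in> E" and meets: "e \<inter> S \<noteq> {}" for e
  proof -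
    obtain s where s: "s \<in> e" "s \<in> S" using meets by blast
    obtain t where t: "e = {t, s}" "t \<noteq> s"
      using edge[OF e] s by (metis card_2_iff doubleton_eq_iff insertE singletonD)
    have tV: "t \<in> V" using edge[OF e] t by blast
    have sN: "s \<in> closed_nbhd V E t \<inter> S"
      using s e t SV by (auto simp: closed_nbhd_def)
    have "t \<notin> S"
    proof
      assume "t \<in> S"
      then have "t \<in> closed_nbhd V E t \<inter> S" by (simp add: closed_nbhd_def)
      from unique_dominator[OF G zero tV this sN] t show False by simp
    qed
    then have "t \<in> T" using tV by (simp add: T_def)
    have "f t \<in> S \<and> {t, f t} \<in> E"
      unfolding f_def by (rule someI[of _ s]) (use s e t in auto)
    then have "f t \<in> closed_nbhd V E t \<inter> S"
      using SV by (auto simp: closed_nbhd_def)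
    from unique_dominator[OF G zero tV this sN] have "f t = s" .
    with t \<open>t \<in> T\<close> show ?thesis by blast
  qed
  have "E \<subseteq> {e. e \<subseteq> T \<and> card e = 2} \<union> (\<lambda>t. {t, f t}) ` T"
  proof
    fix e assume e: "e \<in> E"
    show "e \<in> {e. e \<subseteq> T \<and> card e = 2} \<union> (\<lambda>t. {t, f t}) ` T"
    proof (cases "e \<inter> S = {}")
      case True
      then show ?thesis using edge[OF e] by (auto simp: T_def)
    next
      case False
      then show ?thesis using cross[OF e] by blast
    qed
  qed
  then have "card E \<le> card ({e. e \<subseteq> T \<and> card e = 2} \<union> (\<lambda>t. {t, f t}) ` T)"
    using T by (intro card_mono) auto
  also have "\<dots> \<le> card {e. e \<subseteq> T \<and> card e = 2} + card ((\<lambda>t. {t, f t}) ` T)"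
    by (rule card_Un_le)
  also have "\<dots> \<le> (card T choose 2) + card T"
    using n_subsets[OF T(1), of 2] card_image_le[OF T(1)] by (intro add_mono) auto
  finally show ?thesis by (simp add: T Suc_choose_two)
qed

text \<open>The vertices are \<open>0, \<dots>, n - 1\<close>; the first \<open>r - 1\<close> of them are isolated and the others form
  the clique \<open>K\<close>.\<close>

lemma extremal_graph:
  fixes n r :: nat
  assumes r: "1 \<le> r" "r \<le> n"
  defines "V \<equiv> {..<n}" and "K \<equiv> {r - 1..<n}"
  defines "E \<equiv> {e. e \<subseteq> K \<and> card e = 2}"
  shows "simple_graph V E" "card E = (n - r + 1) choose 2" "CR V E = 0" "gamma_CR V E = r"
proof -
  show G: "simple_graph V E"
    by (auto simp: simple_graph_def V_def K_def E_def)
  have "card K = n - r + 1" using r by (auto simp: K_def)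
  then show "card E = (n - r + 1) choose 2"
    unfolding E_def using n_subsets[of K 2] by (simp add: K_def)
  have nbhd: "closed_nbhd V E u = (if u \<in> K then K else {u})" if "u \<in> V" for u
  proof -
    have "{u, v} \<in> E \<longleftrightarrow> u \<in> K \<and> v \<in> K \<and> u \<noteq> v" for v
      by (auto simp: E_def card_insert_if)
    moreover have "K \<subseteq> V" by (auto simp: V_def K_def)
    ultimately show ?thesis by (auto simp: closed_nbhd_def)
  qed
  have dom0: "dominating V E {..<r}"
    unfolding dominating_def
  proof (intro conjI ballI)
    show "{..<r} \<subseteq> V" using r by (auto simp: V_def)
  next
    fix v assume v: "v \<in> V"
    show "\<exists>s\<in>{..<r}. v \<in> closed_nbhd V E s"
    proof (cases "v \<in> K")
      case True
      \<comment> \<open>\<open>r - 1\<close> is the only clique vertex below \<open>r\<close>.\<close>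
      have "r - 1 \<in> V" "r - 1 \<in> K" "r - 1 < r" using r by (auto simp: V_def K_def)
      then show ?thesis using True nbhd by (intro bexI[of _ "r - 1"]) auto
    next
      case False
      then have "v < r" using v by (auto simp: V_def K_def)
      then show ?thesis by (intro bexI[of _ v]) (auto simp: closed_nbhd_def)
    qed
  qed
  have K0: "K \<inter> {..<r} = {r - 1}" using r by (auto simp: K_def)
  have zero: "CR_set V E {..<r} = 0"
    unfolding CR_set_eq_0_iff[OF G]
  proof
    fix u assume "u \<in> V"
    then show "card (closed_nbhd V E u \<inter> {..<r}) \<le> 1"
      using nbhd K0 card_mono[of "{u}" "{u} \<inter> {..<r}"] by auto
  qed
  have "CR V E \<le> CR_set V E {..<r}"
    unfolding CR_def
    using finite_dominating_image[OF G, of "CR_set V E" "\<lambda>_. True"] dom0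
    by (intro Min_le) auto
  with zero show CR0: "CR V E = 0" by simp
  have lower: "r \<le> card D" if D: "dominating V E D" for D
  proof -
    have DV: "D \<subseteq> V" using D by (simp add: dominating_def)
    then have fin: "finite D" by (auto simp: V_def intro: finite_subset)
    have isolated: "{..<r - 1} \<subseteq> D"
    proof
      fix v assume v: "v \<in> {..<r - 1}"
      then have "v \<in> V" "v \<notin> K" using r by (auto simp: V_def K_def)
      then obtain s where "s \<in> D" "v \<in> closed_nbhd V E s"
        using D by (auto simp: dominating_def)
      then show "v \<in> D" using nbhd[of s] DV \<open>v \<notin> K\<close> by (auto split: if_splits)
    qed
    have "r - 1 \<in> V" "r - 1 \<in> K" using r by (auto simp: V_def K_def)
    then obtain s where s: "s \<in> D" "r - 1 \<in> closed_nbhd V E s"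
      using D by (auto simp: dominating_def)
    then have "s \<in> K" using nbhd[of s] DV \<open>r - 1 \<in> K\<close> by (auto split: if_splits)
    then have "s \<notin> {..<r - 1}" by (auto simp: K_def)
    then have "card (insert s {..<r - 1}) = r" using r by simp
    moreover have "card (insert s {..<r - 1}) \<le> card D"
      using fin s isolated by (intro card_mono) auto
    ultimately show ?thesis by simp
  qed
  have "gamma_CR V E \<le> card {..<r}"
    unfolding gamma_CR_def
    using finite_dominating_image[OF G] dom0 zero CR0
    by (intro Min_le) (auto intro!: exI[of _ "{..<r}"])
  moreover have "r \<le> gamma_CR V E"
    using gamma_CR_attained[OF G] lower by metis
  ultimately show "gamma_CR V E = r" by simp
qed

theorem theorem3p1:
  fixes n r :: nat
  assumes "n \<ge> 2" and "1 \<le> r" and "r \<le> n - 1"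
  shows "M n 0 r = (n - r + 1) choose 2"
proof -
  let ?b = "(n - r + 1) choose 2"
  have upper: "m \<le> ?b" if m: "m \<in> edge_counts n 0 r" for m
  proof -
    obtain V :: "nat set" and E where G: "simple_graph V E" and "m = card E" "card V = n"
      and "CR V E = 0" "gamma_CR V E = r"
      using m by (auto simp: edge_counts_def)
    moreover obtain S where "dominating V E S" "CR_set V E S = CR V E" "card S = gamma_CR V E"
      using gamma_CR_attained[OF G] by blast
    ultimately show ?thesis using card_edges_le[OF G, of S] by simp
  qed
  have "r \<le> n" using assms by simp
  have attained: "?b \<in> edge_counts n 0 r"
    unfolding edge_counts_def
    using extremal_graph[OF assms(2) \<open>r \<le> n\<close>]
    by (intro CollectI exI[of _ "{..<n}"] exI[of _ "{e. e \<subseteq> {r - 1..<n} \<and> card e = 2}"]) simp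
  have "finite (edge_counts n 0 r)"
    by (rule finite_subset[of _ "{..?b}"]) (use upper in auto)
  then have "Max (edge_counts n 0 r) = ?b"
    using upper attained by (intro Max_eqI) auto
  then show ?thesis using attained by (auto simp: M_def)
qed

end
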